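(* Let $v\in\mathcal{P}(\mathbb{X})$ have infinite support and finite entropy $H(v)<\infty$, and let $\mu\in\mathcal{P}(\mathbb{X})$ satisfy $\mu\ll v$ with $0<\inf_{x\in A_\mu}\frac{f_\mu(x)}{f_v(x)}\le\sup_{x\in A_\mu}\frac{f_\mu(x)}{f_v(x)}<\infty$. Let $(a_n)$ and $(h_n)$ be sequences in $(0,1)$ such that (i) $a_n\to0$ and $h_n\to0$, and (ii) there is $\tau\in(0,1/2)$ with $\frac{1}{a_nh_n}=o(n^\tau)$. For each $n$ let $\pi_n=\{A_{n,1},\dots,A_{n,m_n}\}$ be a finite partition of $\mathbb{X}$ with $v(A_{n,i})\ge h_n$ for all $i$, of maximal cardinality among all finite partitions of $\mathbb{X}$ with this property, and let $A_n(x)$ denote the cell of $\pi_n$ containing $x$. Given i.i.d. $X_1,X_2,\dots\sim\mu$, define the Barron estimate $\mu^*_n$ by its pmf $$f_{\mu^*_n}(x)=f_v(x)\Big[(1-a_n)\frac{\hat\mu_n(A_n(x))}{v(A_n(x))}+a_n\Big],\quad x\in\mathbb{X}.$$ Then $H(\mu)<\infty$, $\mu\ll\mu^*_n$ for all $n$, and $$\lim_{n\to\infty}H(\mu^*_n)=H(\mu)\quad\text{and}\quad\lim_{n\to\infty}D(\mu\|\mu^*_n)=0,\qquad\mathbb{P}_\mu\text{-a.s.}$$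
   Context: $\mathbb{X}$ is a countably infinite set and $\mathcal{P}(\mathbb{X})$ the set of probability measures on all subsets of $\mathbb{X}$. For $\mu\in\mathcal{P}(\mathbb{X})$, $f_\mu(x)=\mu(\{x\})$ and $A_\mu=\{x:f_\mu(x)>0\}$. $\log$ is the logarithm to a fixed base $b>1$. Entropy: $H(\mu)=-\sum_{x\in A_\mu}f_\mu(x)\log f_\mu(x)$. I-divergence: $D(\mu\|\nu)=\sum_{x\in A_\mu}f_\mu(x)\log\frac{f_\mu(x)}{f_\nu(x)}$ if $\mu\ll\nu$, and $+\infty$ otherwise. Given i.i.d. $X_1,X_2,\dots\sim\mu$, $\mathbb{P}_\mu$ is the law of the sequence and $\hat\mu_n(A)=\frac1n\sum_{k=1}^n\mathbb{1}_A(X_k)$ the empirical measure. (In the paper the hypothesis on $\mu$ is written $\mu\in\mathbb{H}(\mathbb{X}|v)$, which the paper takes to mean that $\log\frac{d\mu}{dv}$ is bounded on $A_\mu$, as stated above.) *)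

theory Defs
  imports "HOL-Probability.Probability" "HOL-Library.Landau_Symbols"
begin

definition entropy_pmf :: "real \<Rightarrow> 'a pmf \<Rightarrow> ereal" where
  "entropy_pmf b \<mu> =
     enn2ereal (\<integral>\<^sup>+ x. ennreal (- pmf \<mu> x * log b (pmf \<mu> x)) \<partial>count_space (set_pmf \<mu>))"

definition idiv_pmf :: "real \<Rightarrow> 'a pmf \<Rightarrow> 'a pmf \<Rightarrow> ereal" where
  "idiv_pmf b \<mu> \<nu> =
     (if absolutely_continuous (measure_pmf \<nu>) (measure_pmf \<mu>) then
        enn2ereal (\<integral>\<^sup>+ x. ennreal (max 0 (pmf \<mu> x * log b (pmf \<mu> x / pmf \<nu> x)))
                     \<partial>count_space (set_pmf \<mu>))
      - enn2ereal (\<integral>\<^sup>+ x. ennreal (max 0 (- (pmf \<mu> x * log b (pmf \<mu> x / pmf \<nu> x))))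
                     \<partial>count_space (set_pmf \<mu>))
      else \<infinity>)"

definition admissible_partition :: "'a pmf \<Rightarrow> real \<Rightarrow> 'a set set \<Rightarrow> bool" where
  "admissible_partition \<nu> h P \<longleftrightarrow>
     partition_on UNIV P \<and> finite P \<and> (\<forall>A\<in>P. measure_pmf.prob \<nu> A \<ge> h)"

definition maximal_admissible_partition :: "'a pmf \<Rightarrow> real \<Rightarrow> 'a set set \<Rightarrow> bool" where
  "maximal_admissible_partition \<nu> h P \<longleftrightarrow>
     admissible_partition \<nu> h P \<and> (\<forall>Q. admissible_partition \<nu> h Q \<longrightarrow> card Q \<le> card P)"

definition cell :: "'a set set \<Rightarrow> 'a \<Rightarrow> 'a set" where
  "cell P x = (THE A. A \<in> P \<and> x \<in> A)"

text \<open>Empirical measure of the first n observations X_1..X_n = w!!0 .. w!!(n-1).\<close>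
definition empirical :: "'a stream \<Rightarrow> nat \<Rightarrow> 'a set \<Rightarrow> real" where
  "empirical \<omega> n A = (\<Sum>k<n. indicator A (\<omega> !! k)) / real n"

text \<open>The Barron estimate (meaningful for n >= 1).\<close>
definition barron :: "'a pmf \<Rightarrow> (nat \<Rightarrow> 'a set set) \<Rightarrow> (nat \<Rightarrow> real) \<Rightarrow> 'a stream \<Rightarrow> nat \<Rightarrow> 'a pmf" where
  "barron \<nu> \<pi> a \<omega> n = embed_pmf (\<lambda>x. pmf \<nu> x *
      ((1 - a n) * empirical \<omega> n (cell (\<pi> n) x) / measure_pmf.prob \<nu> (cell (\<pi> n) x) + a n))"

end

theory Submission
  imports Defs "HOL-Real_Asymp.Real_Asymp"
begin

text \<open>
  Write \<open>g\<^sub>n\<close> for the density of the Barron estimate with respect to \<open>v\<close> and \<open>\<rho>\<^sub>n(x) = \<mu>(A\<^sub>n(x)) / v(A\<^sub>n(x))\<close>.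
  By Hoeffding's inequality, a union bound over the at most \<open>1 / h\<^sub>n\<close> cells and Borel--Cantelli, almost
  surely the empirical measure is eventually within \<open>a\<^sub>n h\<^sub>n\<close> of \<open>\<mu>\<close> on all cells, which forces
  \<open>(1 - a\<^sub>n) \<rho>\<^sub>n \<le> g\<^sub>n \<le> \<rho>\<^sub>n + 2 a\<^sub>n\<close>. Maximality of the partition gives \<open>v(A\<^sub>n(x) - {x}) < h\<^sub>n\<close> as soon
  as \<open>h\<^sub>n \<le> v(x)\<close>, so \<open>\<rho>\<^sub>n\<close> and \<open>g\<^sub>n\<close> converge pointwise to \<open>r = d\<mu>/dv\<close> and stay bounded.

  The entropies then converge by dominated convergence, the finite entropy of \<open>v\<close> providing the
  dominating function. The lower bound for \<open>g\<^sub>n\<close> shows that the divergence lies between \<open>0\<close> and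
  \<open>\<integral> \<phi>(r) dv - \<integral> \<phi>(\<rho>\<^sub>n) dv - log (1 - a\<^sub>n)\<close> with \<open>\<phi>(t) = t log t\<close>, since \<open>\<rho>\<^sub>n\<close> is constant on cells;
  this tends to \<open>0\<close> by bounded convergence.
\<close>

subsection \<open>Entropy under domination\<close>

text \<open>At \<open>0\<close> the product vanishes, in agreement with the limit of
  \<open>t * ln t\<close> from the right; this is the one point where continuity of the logarithm
  does not suffice.\<close>

lemma continuous_on_xlogx:
  fixes b :: real
  assumes "b > 1"
  shows "continuous_on {0..} (\<lambda>t. t * log b t)"
proof -
  have "((\<lambda>t. t * log b t) \<longlongrightarrow> x * log b x) (at x within {0..})" if "x \<ge> 0" for x
  proof (cases "x = 0")
    case True
    have "((\<lambda>t::real. t * ln t) \<longlongrightarrow> 0) (at_right 0)"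
      by real_asymp
    hence "((\<lambda>t. t * ln t / ln b) \<longlongrightarrow> 0 / ln b) (at_right 0)"
      using assms by (intro tendsto_intros) auto
    thus ?thesis
      using True by (simp add: log_def at_within_Ici_at_right)
  next
    case False
    thus ?thesis
      using that assms by (intro tendsto_intros) auto
  qed
  thus ?thesis
    by (auto simp: continuous_on_def)
qed

lemma xlogx_bounded:
  fixes b K :: real
  assumes "b > 1"
  obtains B where "\<And>t. 0 \<le> t \<Longrightarrow> t \<le> K \<Longrightarrow> \<bar>t * log b t\<bar> \<le> B"
proof -
  have "continuous_on {0..K} (\<lambda>t. t * log b t)"
    by (rule continuous_on_subset[OF continuous_on_xlogx[OF assms]]) auto
  hence "bounded ((\<lambda>t. t * log b t) ` {0..K})"
    by (intro compact_imp_bounded compact_continuous_image) auto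
  then obtain B where "\<forall>t\<in>{0..K}. \<bar>t * log b t\<bar> \<le> B"
    by (auto simp: bounded_iff)
  thus thesis
    using that[of B] by simp
qed

lemma tendsto_xlogx:
  fixes b :: real
  assumes "b > 1" "f \<longlonglongrightarrow> l" "eventually (\<lambda>n. f n \<ge> 0) sequentially"
  shows "(\<lambda>n. f n * log b (f n)) \<longlonglongrightarrow> l * log b l"
proof -
  have "l \<ge> 0"
    using assms(2,3) by (rule tendsto_lowerbound) auto
  thus ?thesis
    using continuous_on_tendsto_compose[OF continuous_on_xlogx[OF assms(1)] assms(2)] assms(3)
    by simp
qed

text \<open>The bounds used later hold only from some index on, so dominated convergence is applied
  to the shifted sequence.\<close>

lemma pmf_dominated_convergence:
  fixes f :: "'a \<Rightarrow> real"
  assumes w: "integrable (measure_pmf p) w"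
    and bnd: "eventually (\<lambda>n. \<forall>x\<in>set_pmf p. \<bar>s n x\<bar> \<le> w x) sequentially"
    and lim: "\<And>x. x \<in> set_pmf p \<Longrightarrow> (\<lambda>n. s n x) \<longlonglongrightarrow> f x"
  shows "(\<lambda>n. measure_pmf.expectation p (s n)) \<longlonglongrightarrow> measure_pmf.expectation p f"
proof -
  obtain N where N: "\<And>n x. n \<ge> N \<Longrightarrow> x \<in> set_pmf p \<Longrightarrow> \<bar>s n x\<bar> \<le> w x"
    using bnd by (auto simp: eventually_sequentially)
  have "(\<lambda>n. measure_pmf.expectation p (s (n + N))) \<longlonglongrightarrow> measure_pmf.expectation p f"
    using w by (rule integral_dominated_convergence[rotated 2])
      (auto simp: AE_measure_pmf_iff N intro!: LIMSEQ_ignore_initial_segment[OF lim])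
  thus ?thesis
    by (rule LIMSEQ_offset)
qed

section \<open>Change of measure under domination by \<open>v\<close>\<close>

lemma pmf_zero_of_dominated:
  fixes K :: real
  assumes "\<And>x. pmf \<mu> x \<le> K * pmf v x" "pmf v x = 0"
  shows "pmf \<mu> x = 0"
  using assms(1)[of x] assms(2) pmf_nonneg[of \<mu> x] by simp

text \<open>\<open>r\<close> acts as a density of \<open>\<mu>\<close> with respect to
  \<open>v\<close>, so that quantities under \<open>\<mu>\<close> become integrals against the fixed
  law \<open>v\<close>.\<close>

lemma
  fixes f :: "'a \<Rightarrow> real"
  assumes dens: "\<And>x. pmf \<mu> x = pmf v x * r x" "\<And>x. r x \<ge> 0"
  shows expectation_pmf_density:
      "measure_pmf.expectation \<mu> f = measure_pmf.expectation v (\<lambda>x. r x * f x)"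
    and integrable_pmf_density:
      "integrable (measure_pmf \<mu>) f \<longleftrightarrow> integrable (measure_pmf v) (\<lambda>x. r x * f x)"
proof -
  have eq: "measure_pmf \<mu> = density (measure_pmf v) r"
    unfolding measure_pmf_eq_density
    by (subst density_density_eq) (auto simp: dens ennreal_mult)
  show "measure_pmf.expectation \<mu> f = measure_pmf.expectation v (\<lambda>x. r x * f x)"
    unfolding eq by (subst integral_density) (auto simp: dens)
  show "integrable (measure_pmf \<mu>) f \<longleftrightarrow> integrable (measure_pmf v) (\<lambda>x. r x * f x)"
    unfolding eq by (subst integrable_density) (auto simp: dens)
qed

text \<open>Where \<open>pmf v x = 0\<close>, domination forces \<open>pmf \<mu> x = 0\<close>, so
  the default value \<open>0\<close> of the quotient is harmless and the ratio is a density
  everywhere.\<close>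

lemma pmf_eq_mult_ratio:
  fixes K :: real
  assumes "\<And>x. pmf \<mu> x \<le> K * pmf v x"
  shows "pmf \<mu> x = pmf v x * (pmf \<mu> x / pmf v x)"
  using pmf_zero_of_dominated[OF assms] by simp

lemma ratio_le:
  fixes K :: real
  assumes "\<And>x. pmf \<mu> x \<le> K * pmf v x" "x \<in> set_pmf v"
  shows "pmf \<mu> x / pmf v x \<le> K"
  using assms pmf_positive[of x v] by (simp add: pos_divide_le_eq)

text \<open>The density is at most \<open>K\<close> on the support of \<open>v\<close>; this bound
  is integrated over \<open>A\<close>.\<close>

lemma measure_le_of_dominated:
  fixes K :: real
  assumes dom: "\<And>x. pmf \<mu> x \<le> K * pmf v x"
  shows "measure_pmf.prob \<mu> A \<le> K * measure_pmf.prob v A"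
proof -
  have "measure_pmf.prob \<mu> A = measure_pmf.expectation \<mu> (indicator A)"
    by simp
  also have "\<dots> = measure_pmf.expectation v (\<lambda>x. pmf \<mu> x / pmf v x * indicator A x)"
    by (rule expectation_pmf_density) (use pmf_eq_mult_ratio[OF dom] in auto)
  also have "\<dots> \<le> measure_pmf.expectation v (\<lambda>x. K * indicator A x)"
  proof (rule integral_mono_AE)
    show "integrable (measure_pmf v) (\<lambda>x. pmf \<mu> x / pmf v x * indicator A x)"
      using integrable_pmf_density[of \<mu> v "\<lambda>x. pmf \<mu> x / pmf v x" "indicator A"]
        pmf_eq_mult_ratio[OF dom] by (auto intro: measure_pmf.integrable_const_bound[where B = 1])
  next
    show "integrable (measure_pmf v) (\<lambda>x. K * indicator A x)"
      by (intro measure_pmf.integrable_const_bound[where B = "\<bar>K\<bar>"]) (auto simp: indicator_def)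
  qed (auto simp: AE_measure_pmf_iff indicator_def ratio_le[OF dom])
  finally show ?thesis
    by simp
qed

section \<open>Entropy as an integral against the reference law\<close>

text \<open>Puts the entropies of different \<open>q\<close> on the common measure \<open>v\<close>.
  The summand carries the factor \<open>pmf q x\<close>, so extending the sum beyond the support of
  \<open>q\<close> adds nothing.\<close>

lemma entropy_pmf_density:
  fixes b :: real
  assumes b: "b > 1" and dens: "\<And>x. pmf q x = pmf v x * g x" "\<And>x. g x \<ge> 0"
  shows "entropy_pmf b q
    = enn2ereal (\<integral>\<^sup>+ x. ennreal (- (g x * log b (pmf q x))) \<partial>measure_pmf v)"
proof -
  have "(\<integral>\<^sup>+ x. ennreal (- pmf q x * log b (pmf q x)) \<partial>count_space (set_pmf q))
      = (\<integral>\<^sup>+ x. ennreal (- pmf q x * log b (pmf q x)) \<partial>count_space UNIV)"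
    by (rule nn_integral_count_space_eq) (auto simp: set_pmf_iff)
  also have "\<dots> = (\<integral>\<^sup>+ x. ennreal (pmf v x) * ennreal (- (g x * log b (pmf q x))) \<partial>count_space UNIV)"
    by (intro nn_integral_cong) (simp add: dens(1) ennreal_mult'[symmetric] mult.assoc)
  also have "\<dots> = (\<integral>\<^sup>+ x. ennreal (- (g x * log b (pmf q x))) \<partial>measure_pmf v)"
    by (rule nn_integral_measure_pmf[symmetric])
  finally show ?thesis
    by (simp add: entropy_pmf_def)
qed

lemma log_pmf_nonpos:
  fixes b :: real
  assumes "b > 1"
  shows "log b (pmf q x) \<le> 0"
proof (cases "pmf q x = 0")
  case False
  thus ?thesis
    using assms pmf_le_1[of q x] by (simp add: pmf_pos)
qed (simp add: log_def)

text \<open>With density \<open>1\<close> the entropy of \<open>v\<close> is the integral of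
  \<open>- log b (pmf v x)\<close>, which has constant sign, so finite entropy amounts to
  integrability.\<close>

lemma integrable_log_pmf:
  fixes b :: real
  assumes b: "b > 1" and v: "entropy_pmf b v < \<infinity>"
  shows "integrable (measure_pmf v) (\<lambda>x. log b (pmf v x))"
proof -
  have "(\<integral>\<^sup>+ x. ennreal (- (1 * log b (pmf v x))) \<partial>measure_pmf v) < \<infinity>"
    using v entropy_pmf_density[OF b, of v v "\<lambda>_. 1"]
    by (metis enn2ereal_eq_top_iff ennreal_zero_less_top infinity_ennreal_def less_irrefl
        mult.right_neutral top.not_eq_extremum top_ereal_def zero_le_one)
  hence "integrable (measure_pmf v) (\<lambda>x. - log b (pmf v x))"
    using log_pmf_nonpos[OF b, of v] by (intro integrableI_nonneg) (auto simp: less_top)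
  thus ?thesis
    by simp
qed

text \<open>The majorant depends on \<open>v\<close> and \<open>K\<close> only and serves all
  \<open>q\<close> at once. With \<open>g\<close> the ratio, the integrand splits into
  \<open>g * log b (pmf v x)\<close>, controlled by the finite entropy of \<open>v\<close>, and
  \<open>g * log b g\<close>, bounded on \<open>[0, K]\<close>.\<close>

lemma entropy_integrand_bound:
  fixes b K :: real
  assumes b: "b > 1"
    and v: "entropy_pmf b v < \<infinity>"
  obtains w where "integrable (measure_pmf v) w"
    "\<And>q x. (\<And>x. pmf q x \<le> K * pmf v x) \<Longrightarrow> x \<in> set_pmf v
       \<Longrightarrow> \<bar>pmf q x / pmf v x * log b (pmf q x)\<bar> \<le> w x"
proof -
  obtain B where B: "\<And>t. 0 \<le> t \<Longrightarrow> t \<le> K \<Longrightarrow> \<bar>t * log b t\<bar> \<le> B"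
    using xlogx_bounded[OF b] by blast
  have "\<bar>pmf q x / pmf v x * log b (pmf q x)\<bar> \<le> \<bar>K\<bar> * \<bar>log b (pmf v x)\<bar> + B"
    if dom: "\<And>x. pmf q x \<le> K * pmf v x" and x: "x \<in> set_pmf v" for q x
  proof -
    define g where "g = pmf q x / pmf v x"
    have vx: "pmf v x > 0"
      using x by (simp add: pmf_positive)
    have g: "0 \<le> g" "g \<le> K" and q: "pmf q x = pmf v x * g"
      using ratio_le[OF dom x] vx by (auto simp: g_def)
    \<comment> \<open>Splitting the logarithm requires \<open>g > 0\<close>; at \<open>g = 0\<close>
      both sides vanish.\<close>
    have "g * log b (pmf q x) = g * log b (pmf v x) + g * log b g"
      using g b vx by (cases "g = 0") (simp_all add: q log_mult algebra_simps)
    also have "\<bar>\<dots>\<bar> \<le> \<bar>K\<bar> * \<bar>log b (pmf v x)\<bar> + B"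
      using g B[OF g]
      by (intro order.trans[OF abs_triangle_ineq] add_mono) (auto simp: abs_mult intro!: mult_right_mono)
    finally show ?thesis
      by (simp add: g_def)
  qed
  moreover have "integrable (measure_pmf v) (\<lambda>x. \<bar>K\<bar> * \<bar>log b (pmf v x)\<bar> + B)"
    using integrable_log_pmf[OF b v] by simp
  ultimately show thesis
    using that by blast
qed

lemma entropy_of_dominated:
  fixes b K :: real
  assumes b: "b > 1"
    and v: "entropy_pmf b v < \<infinity>"
    and dom: "\<And>x. pmf q x \<le> K * pmf v x"
  shows "entropy_pmf b q
    = ereal (measure_pmf.expectation v (\<lambda>x. - (pmf q x / pmf v x * log b (pmf q x))))"
proof -
  let ?f = "\<lambda>x. - (pmf q x / pmf v x * log b (pmf q x))"
  obtain w where w: "integrable (measure_pmf v) w"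
    "\<And>x. x \<in> set_pmf v \<Longrightarrow> \<bar>pmf q x / pmf v x * log b (pmf q x)\<bar> \<le> w x"
    using entropy_integrand_bound[OF b v, of K] dom by metis
  have "integrable (measure_pmf v) ?f"
    by (rule Bochner_Integration.integrable_bound[OF w(1)])
       (use w(2) in \<open>force simp: AE_measure_pmf_iff\<close>)+
  moreover have "?f x \<ge> 0" for x
    using log_pmf_nonpos[OF b, of q x] by (simp add: mult_nonneg_nonpos divide_nonpos_nonneg)
  ultimately have "(\<integral>\<^sup>+ x. ennreal (?f x) \<partial>measure_pmf v) = ennreal (measure_pmf.expectation v ?f)"
    and "measure_pmf.expectation v ?f \<ge> 0"
    by (auto intro: nn_integral_eq_integral integral_nonneg simp del: mult_minus_left integral_minus
        Bochner_Integration.integral_minus times_divide_eq_left)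
  thus ?thesis
    using entropy_pmf_density[OF b pmf_eq_mult_ratio[OF dom]] by simp
qed

lemma entropy_tendsto_of_dominated:
  fixes b K :: real
  assumes b: "b > 1"
    and v: "entropy_pmf b v < \<infinity>"
    and \<mu>: "\<And>x. pmf \<mu> x \<le> K * pmf v x"
    and q: "eventually (\<lambda>n. \<forall>x. pmf (q n) x \<le> K * pmf v x) sequentially"
    and lim: "\<And>x. x \<in> set_pmf v \<Longrightarrow> (\<lambda>n. pmf (q n) x) \<longlonglongrightarrow> pmf \<mu> x"
  shows "(\<lambda>n. entropy_pmf b (q n)) \<longlonglongrightarrow> entropy_pmf b \<mu>"
proof -
  let ?F = "\<lambda>q x. - (pmf q x / pmf v x * log b (pmf q x))"
  obtain w where w: "integrable (measure_pmf v) w"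
    "\<And>q x. (\<And>x. pmf q x \<le> K * pmf v x) \<Longrightarrow> x \<in> set_pmf v
       \<Longrightarrow> \<bar>pmf q x / pmf v x * log b (pmf q x)\<bar> \<le> w x"
    using entropy_integrand_bound[OF b v, of K] by blast
  have "(\<lambda>n. measure_pmf.expectation v (?F (q n))) \<longlonglongrightarrow> measure_pmf.expectation v (?F \<mu>)"
  proof (rule pmf_dominated_convergence[OF w(1)])
    show "eventually (\<lambda>n. \<forall>x\<in>set_pmf v. \<bar>?F (q n) x\<bar> \<le> w x) sequentially"
      using q by eventually_elim (use w(2) in auto)
  next
    fix x assume x: "x \<in> set_pmf v"
    \<comment> \<open>Grouping the numerator as \<open>t * log b t\<close> with
      \<open>t = pmf (q n) x\<close> covers the limit \<open>0\<close> too, where the logarithm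
      alone may diverge.\<close>
    have "(\<lambda>n. - (pmf (q n) x * log b (pmf (q n) x) / pmf v x))
        \<longlonglongrightarrow> - (pmf \<mu> x * log b (pmf \<mu> x) / pmf v x)"
      using x by (intro tendsto_intros tendsto_xlogx[OF b lim[OF x]]) (auto simp: set_pmf_iff)
    thus "(\<lambda>n. ?F (q n) x) \<longlonglongrightarrow> ?F \<mu> x"
      by simp
  qed
  moreover have "eventually (\<lambda>n. entropy_pmf b (q n) = ereal (measure_pmf.expectation v (?F (q n)))) sequentially"
    using q by eventually_elim (rule entropy_of_dominated[OF b v, of _ K], blast)
  ultimately show ?thesis
    unfolding entropy_of_dominated[OF b v \<mu>] by (subst tendsto_cong) (auto intro!: tendsto_intros)
qed

subsection \<open>I-divergence\<close>

lemma absolutely_continuous_measure_pmf_iff: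
  "absolutely_continuous (measure_pmf \<nu>) (measure_pmf \<mu>) \<longleftrightarrow> set_pmf \<mu> \<subseteq> set_pmf \<nu>"
proof -
  have null: "A \<in> null_sets (measure_pmf p) \<longleftrightarrow> set_pmf p \<inter> A = {}" for p :: "'b pmf" and A
    by (simp add: null_sets_def measure_pmf.emeasure_eq_measure measure_pmf_zero_iff)
  show ?thesis
    unfolding absolutely_continuous_def by (auto simp: null subset_iff)
qed

text \<open>The nonnegative weight can be pulled out of \<open>max\<close>, so the two sums in
  \<open>idiv_pmf\<close> are the integrals of the positive and negative parts under
  \<open>\<mu>\<close>. Integrability makes both finite, and their \<open>ereal\<close> difference
  is a real subtraction.\<close>

lemma idiv_pmf_eq_expectation:
  fixes b :: real
  assumes sub: "set_pmf \<mu> \<subseteq> set_pmf \<nu>"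
    and int: "integrable (measure_pmf \<mu>) (\<lambda>x. log b (pmf \<mu> x / pmf \<nu> x))"
  shows "idiv_pmf b \<mu> \<nu> = ereal (measure_pmf.expectation \<mu> (\<lambda>x. log b (pmf \<mu> x / pmf \<nu> x)))"
proof -
  let ?L = "\<lambda>x. log b (pmf \<mu> x / pmf \<nu> x)"
  have eq: "(\<integral>\<^sup>+ x. ennreal (max 0 (pmf \<mu> x * f x)) \<partial>count_space (set_pmf \<mu>))
      = (\<integral>\<^sup>+ x. ennreal (f x) \<partial>measure_pmf \<mu>)" for f :: "_ \<Rightarrow> real"
  proof -
    have "(\<integral>\<^sup>+ x. ennreal (max 0 (pmf \<mu> x * f x)) \<partial>count_space (set_pmf \<mu>))
      = (\<integral>\<^sup>+ x. ennreal (pmf \<mu> x * f x) \<partial>count_space (set_pmf \<mu>))"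
      by (intro nn_integral_cong) (auto simp: max_def ennreal_neg)
    also have "\<dots> = (\<integral>\<^sup>+ x. ennreal (pmf \<mu> x * f x) \<partial>count_space UNIV)"
      by (rule nn_integral_count_space_eq) (auto simp: set_pmf_iff)
    finally show ?thesis
      by (simp add: nn_integral_measure_pmf ennreal_mult')
  qed
  have fin: "(\<integral>\<^sup>+ x. ennreal (?L x) \<partial>measure_pmf \<mu>) \<noteq> \<infinity>"
    "(\<integral>\<^sup>+ x. ennreal (- ?L x) \<partial>measure_pmf \<mu>) \<noteq> \<infinity>"
    using int by (auto simp: real_integrable_def)
  have "ereal (measure_pmf.expectation \<mu> ?L)
      = ereal (enn2real (\<integral>\<^sup>+ x. ennreal (?L x) \<partial>measure_pmf \<mu>))
        - ereal (enn2real (\<integral>\<^sup>+ x. ennreal (- ?L x) \<partial>measure_pmf \<mu>))"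
    unfolding real_lebesgue_integral_def[OF int] by simp
  also have "\<dots> = enn2ereal (\<integral>\<^sup>+ x. ennreal (?L x) \<partial>measure_pmf \<mu>)
      - enn2ereal (\<integral>\<^sup>+ x. ennreal (- ?L x) \<partial>measure_pmf \<mu>)"
    using fin
    by (simp add: enn2ereal_ennreal[OF enn2real_nonneg, symmetric] less_top)
  finally show ?thesis
    using sub eq[of ?L] eq[of "\<lambda>x. - ?L x"]
    by (simp add: idiv_pmf_def absolutely_continuous_measure_pmf_iff)
qed

text \<open>Only the mass of \<open>q\<close> on the support of \<open>p\<close> is counted; mass of
  \<open>q\<close> outside it is why the bound is an inequality.\<close>

lemma
  fixes p q :: "'a pmf"
  shows integrable_pmf_ratio: "integrable (measure_pmf p) (\<lambda>x. pmf q x / pmf p x)"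
    and expectation_pmf_ratio_le_1: "measure_pmf.expectation p (\<lambda>x. pmf q x / pmf p x) \<le> 1"
proof -
  have "(\<integral>\<^sup>+ x. ennreal (pmf q x / pmf p x) \<partial>measure_pmf p)
      \<le> (\<integral>\<^sup>+ x. ennreal (pmf q x) \<partial>count_space UNIV)"
    unfolding nn_integral_measure_pmf
    by (intro nn_integral_mono) (simp add: ennreal_mult'[symmetric] ennreal_leI)
  also have "\<dots> = 1"
    by (simp add: nn_integral_pmf)
  finally have le: "(\<integral>\<^sup>+ x. ennreal (pmf q x / pmf p x) \<partial>measure_pmf p) \<le> 1" .
  show int: "integrable (measure_pmf p) (\<lambda>x. pmf q x / pmf p x)"
  proof (rule integrableI_nonneg)
    show "(\<integral>\<^sup>+ x. ennreal (pmf q x / pmf p x) \<partial>measure_pmf p) < \<infinity>"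
      using le by (rule le_less_trans) simp
  qed auto
  show "measure_pmf.expectation p (\<lambda>x. pmf q x / pmf p x) \<le> 1"
    using le nn_integral_eq_integral[OF int] by simp
qed

text \<open>This is \<open>ln u \<le> u - 1\<close> at \<open>u = t / s\<close>; it gives the log
  ratio a minorant whose expectation is under control.\<close>

lemma log_ratio_ge:
  fixes b s t :: real
  assumes "b > 1" "s > 0" "t > 0"
  shows "(1 - t / s) / ln b \<le> log b (s / t)"
proof -
  have "ln (t / s) \<le> t / s - 1"
    using assms by (intro ln_le_minus_one) auto
  thus ?thesis
    using assms by (auto simp: log_def ln_div intro!: divide_right_mono)
qed

text \<open>The lower bound is Gibbs' inequality.\<close>

lemma
  fixes b :: real
  assumes b: "b > 1" and sub: "set_pmf \<mu> \<subseteq> set_pmf q"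
    and U: "integrable (measure_pmf \<mu>) U"
    and le: "\<And>x. x \<in> set_pmf \<mu> \<Longrightarrow> log b (pmf \<mu> x / pmf q x) \<le> U x"
  shows idiv_pmf_nonneg: "0 \<le> idiv_pmf b \<mu> q"
    and idiv_pmf_le: "idiv_pmf b \<mu> q \<le> ereal (measure_pmf.expectation \<mu> U)"
proof -
  let ?L = "\<lambda>x. log b (pmf \<mu> x / pmf q x)"
  let ?W = "\<lambda>x. (1 - pmf q x / pmf \<mu> x) / ln b"
  have W: "integrable (measure_pmf \<mu>) ?W"
    using integrable_pmf_ratio[of \<mu> q] by simp
  have WL: "?W x \<le> ?L x" if "x \<in> set_pmf \<mu>" for x
    using that sub b by (intro log_ratio_ge) (auto intro!: pmf_positive)
  \<comment> \<open>\<open>?L\<close> lies between the integrable functions \<open>?W\<close> and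
    \<open>U\<close>, so the sum of their absolute values majorises it.\<close>
  have int: "integrable (measure_pmf \<mu>) ?L"
  proof (rule Bochner_Integration.integrable_bound)
    show "integrable (measure_pmf \<mu>) (\<lambda>x. \<bar>U x\<bar> + \<bar>?W x\<bar>)"
      by (intro Bochner_Integration.integrable_add integrable_abs U W)
    show "AE x in measure_pmf \<mu>. norm (?L x) \<le> norm (\<bar>U x\<bar> + \<bar>?W x\<bar>)"
      unfolding AE_measure_pmf_iff real_norm_def
    proof
      fix x assume "x \<in> set_pmf \<mu>"
      from le[OF this] WL[OF this] show "\<bar>?L x\<bar> \<le> \<bar>\<bar>U x\<bar> + \<bar>?W x\<bar>\<bar>"
        by linarith
    qed
  qed simp
  have "0 \<le> (1 - measure_pmf.expectation \<mu> (\<lambda>x. pmf q x / pmf \<mu> x)) / ln b"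
    using expectation_pmf_ratio_le_1[where p = \<mu> and q = q] b by simp
  also have "\<dots> = measure_pmf.expectation \<mu> ?W"
    using integrable_pmf_ratio[of \<mu> q] by simp
  also have "\<dots> \<le> measure_pmf.expectation \<mu> ?L"
    using W int WL by (intro integral_mono_AE) (auto simp: AE_measure_pmf_iff)
  finally show "0 \<le> idiv_pmf b \<mu> q"
    using idiv_pmf_eq_expectation[OF sub int] by simp
  have "measure_pmf.expectation \<mu> ?L \<le> measure_pmf.expectation \<mu> U"
    using U int le by (intro integral_mono_AE) (auto simp: AE_measure_pmf_iff)
  thus "idiv_pmf b \<mu> q \<le> ereal (measure_pmf.expectation \<mu> U)"
    using idiv_pmf_eq_expectation[OF sub int] by simp
qed

subsection \<open>Maximal partitions\<close>

lemma
  assumes P: "partition_on UNIV P"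
  shows cell_in_partition: "cell P x \<in> P"
    and in_cell: "x \<in> cell P x"
    and cell_eqI: "A \<in> P \<Longrightarrow> x \<in> A \<Longrightarrow> cell P x = A"
proof -
  have uniq: "A = B" if "A \<in> P" "x \<in> A" "B \<in> P" "x \<in> B" for A B
    using that partition_onD2[OF P] by (auto simp: disjoint_def)
  obtain A where A: "A \<in> P" "x \<in> A"
    using partition_onD1[OF P] by blast
  have "cell P x \<in> P \<and> x \<in> cell P x"
    unfolding cell_def by (rule theI[of _ A]) (use A uniq in auto)
  thus "cell P x \<in> P" "x \<in> cell P x"
    by auto
  thus "A \<in> P \<Longrightarrow> x \<in> A \<Longrightarrow> cell P x = A" for A
    using uniq by blast
qed

lemma vimage_cell:
  assumes P: "partition_on UNIV P" and "A \<in> P"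
  shows "cell P -` {A} = A"
  using assms in_cell[OF P] cell_eqI[OF P] by auto

text \<open>Under \<open>cell P\<close> the law \<open>p\<close> becomes a finitely supported pmf on
  \<open>P\<close> whose atoms are the cell masses.\<close>

lemma
  fixes F :: "'a set \<Rightarrow> real"
  assumes P: "partition_on UNIV P" "finite P"
  shows integrable_cell: "integrable (measure_pmf p) (\<lambda>x. F (cell P x))"
    and expectation_cell:
      "measure_pmf.expectation p (\<lambda>x. F (cell P x)) = (\<Sum>A\<in>P. F A * measure_pmf.prob p A)"
proof -
  have sub: "set_pmf (map_pmf (cell P) p) \<subseteq> P"
    using cell_in_partition[OF P(1)] by auto
  have "integrable (measure_pmf (map_pmf (cell P) p)) F"
    using finite_subset[OF sub P(2)] by (rule integrable_measure_pmf_finite)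
  thus "integrable (measure_pmf p) (\<lambda>x. F (cell P x))"
    by (simp add: integrable_map_pmf_eq)
  have "measure_pmf.expectation p (\<lambda>x. F (cell P x)) = measure_pmf.expectation (map_pmf (cell P) p) F"
    by simp
  also have "\<dots> = (\<Sum>A\<in>P. F A * pmf (map_pmf (cell P) p) A)"
    using P(2) sub by (intro integral_measure_pmf_real) auto
  also have "\<dots> = (\<Sum>A\<in>P. F A * measure_pmf.prob p A)"
    by (intro sum.cong) (simp_all add: pmf_map vimage_cell[OF P(1)])
  finally show "measure_pmf.expectation p (\<lambda>x. F (cell P x)) = (\<Sum>A\<in>P. F A * measure_pmf.prob p A)" .
qed

lemma sum_prob_partition:
  assumes "partition_on UNIV P" "finite P"
  shows "(\<Sum>A\<in>P. measure_pmf.prob p A) = 1"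
  using expectation_cell[OF assms, of p "\<lambda>_. 1"] by simp

lemma sum_empirical_partition:
  assumes P: "partition_on UNIV P" "finite P" and n: "n \<ge> 1"
  shows "(\<Sum>A\<in>P. empirical \<omega> n A) = 1"
proof -
  \<comment> \<open>For one observation the indicators are the cell masses of a point mass, hence
    add up to \<open>1\<close>.\<close>
  have "(\<Sum>A\<in>P. indicator A (\<omega> !! k) :: real) = 1" for k
    using sum_prob_partition[OF P, of "return_pmf (\<omega> !! k)"] by simp
  hence "(\<Sum>A\<in>P. \<Sum>k<n. indicator A (\<omega> !! k) :: real) = real n"
    by (subst sum.swap) simp
  thus ?thesis
    using n by (simp add: empirical_def sum_divide_distrib[symmetric])
qed

text \<open>Disjoint cells of mass at least \<open>h\<close> share the total mass \<open>1\<close>.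
  This counts the events in the later union bound.\<close>

lemma card_admissible_partition_le:
  assumes "admissible_partition v h P" "h > 0"
  shows "real (card P) \<le> 1 / h"
proof -
  have P: "partition_on UNIV P" "finite P" "\<And>A. A \<in> P \<Longrightarrow> h \<le> measure_pmf.prob v A"
    using assms(1) by (auto simp: admissible_partition_def)
  have "real (card P) * h \<le> (\<Sum>A\<in>P. measure_pmf.prob v A)"
    using P(3) sum_mono[of P "\<lambda>_. h" "measure_pmf.prob v"] by simp
  also have "\<dots> = 1"
    by (rule sum_prob_partition[OF P(1,2)])
  finally show ?thesis
    using assms(2) by (simp add: field_simps)
qed

text \<open>Otherwise the cell could be split into \<open>{x}\<close> and the rest.\<close>

lemma prob_cell_minus_atom_less:
  assumes max: "maximal_admissible_partition v h P" and h: "0 < h" "h \<le> pmf v x"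
  shows "measure_pmf.prob v (cell P x - {x}) < h"
proof (rule ccontr)
  assume "\<not> ?thesis"
  hence ge: "h \<le> measure_pmf.prob v (cell P x - {x})"
    by simp
  define A where "A = cell P x"
  define Q where "Q = insert {x} (insert (A - {x}) (P - {A}))"
  have P: "partition_on UNIV P" "finite P" "\<And>A. A \<in> P \<Longrightarrow> h \<le> measure_pmf.prob v A"
    using max by (auto simp: maximal_admissible_partition_def admissible_partition_def)
  have A: "A \<in> P" "x \<in> A"
    using cell_in_partition[OF P(1)] in_cell[OF P(1)] by (auto simp: A_def)
  have ne: "A - {x} \<noteq> {}"
    using ge h(1) by (metis A_def measure_empty not_le)
  have disj: "B \<inter> A = {}" if "B \<in> P" "B \<noteq> A" for B
    using that A partition_onD2[OF P(1)] by (auto simp: disjoint_def)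
  have "disjoint (P - {A})"
    using partition_onD2[OF P(1)] by (rule pairwise_subset) auto
  hence "partition_on UNIV Q"
    using partition_onD1[OF P(1)] partition_onD3[OF P(1)] A ne disj
    unfolding partition_on_def Q_def by (auto simp: pairwise_insert disjnt_def)
  moreover have "h \<le> measure_pmf.prob v B" if "B \<in> Q" for B
    using that ge h P(3) by (auto simp: Q_def A_def measure_pmf_single)
  ultimately have "admissible_partition v h Q"
    using P(2) by (auto simp: admissible_partition_def Q_def)
  hence "card Q \<le> card P"
    using max by (auto simp: maximal_admissible_partition_def)
  \<comment> \<open>The cardinality grows only if both pieces are new: each is nonempty and meets
    \<open>A\<close>, so it is no other cell, and the two differ at \<open>x\<close>.\<close>
  moreover have "{x} \<notin> insert (A - {x}) (P - {A})" "A - {x} \<notin> P - {A}"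
    using disj[of "{x}"] disj[of "A - {x}"] A ne by auto
  hence "card Q = card P + 1"
    using P(2) A card_Suc_Diff1[of P A] by (simp add: Q_def)
  ultimately show False
    by simp
qed

section \<open>Divergence compared with the cell ratios\<close>

text \<open>\<open>\<rho>\<close> is constant on cells, so both sides are the same finite sum:
  weighting a cell by its \<open>\<mu>\<close>-mass is weighting it by \<open>\<rho>\<close> times
  its \<open>v\<close>-mass.\<close>

lemma expectation_xlogx_cell_ratio:
  fixes b :: real and \<mu> v :: "'a pmf"
  assumes P: "partition_on UNIV P" "finite P" and pos: "\<And>A. A \<in> P \<Longrightarrow> measure_pmf.prob v A > 0"
  defines "\<rho> \<equiv> \<lambda>x. measure_pmf.prob \<mu> (cell P x) / measure_pmf.prob v (cell P x)"
  shows "measure_pmf.expectation \<mu> (\<lambda>x. log b (\<rho> x)) = measure_pmf.expectation v (\<lambda>x. \<rho> x * log b (\<rho> x))"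
  unfolding \<rho>_def
    expectation_cell[OF P, of \<mu> "\<lambda>A. log b (measure_pmf.prob \<mu> A / measure_pmf.prob v A)"]
    expectation_cell[OF P, of v "\<lambda>A. measure_pmf.prob \<mu> A / measure_pmf.prob v A *
       log b (measure_pmf.prob \<mu> A / measure_pmf.prob v A)"]
proof (intro sum.cong refl)
  fix A assume "A \<in> P"
  from pos[OF this]
  show "log b (measure_pmf.prob \<mu> A / measure_pmf.prob v A) * measure_pmf.prob \<mu> A
      = measure_pmf.prob \<mu> A / measure_pmf.prob v A
        * log b (measure_pmf.prob \<mu> A / measure_pmf.prob v A) * measure_pmf.prob v A"
    by simp
qed

text \<open>As \<open>q\<close> has \<open>v\<close>-density at least \<open>c * \<rho>\<close>, the
  log ratio is at most \<open>log b (r x) - log b (\<rho> x) - log b c\<close> on the support of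
  \<open>\<mu>\<close>. Integrating under \<open>\<mu>\<close> and changing the measure to
  \<open>v\<close> term by term gives the upper bound.\<close>

lemma idiv_pmf_cell_ratio_bounds:
  fixes b c K :: real
  assumes b: "b > 1" and dom: "\<And>x. pmf \<mu> x \<le> K * pmf v x"
    and P: "partition_on UNIV P" "finite P" and pos: "\<And>A. A \<in> P \<Longrightarrow> measure_pmf.prob v A > 0"
    and c: "c > 0"
  defines "\<rho> \<equiv> \<lambda>x. measure_pmf.prob \<mu> (cell P x) / measure_pmf.prob v (cell P x)"
  defines "r \<equiv> \<lambda>x. pmf \<mu> x / pmf v x"
  assumes q: "\<And>x. c * \<rho> x * pmf v x \<le> pmf q x"
  shows "0 \<le> idiv_pmf b \<mu> q"
    and "idiv_pmf b \<mu> q \<le> ereal (measure_pmf.expectation v (\<lambda>x. r x * log b (r x))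
            - measure_pmf.expectation v (\<lambda>x. \<rho> x * log b (\<rho> x)) - log b c)"
proof -
  have r: "pmf \<mu> x = pmf v x * r x" "r x \<ge> 0" for x
    unfolding r_def by (rule pmf_eq_mult_ratio[OF dom]) auto
  obtain B where B: "\<And>t. 0 \<le> t \<Longrightarrow> t \<le> K \<Longrightarrow> \<bar>t * log b t\<bar> \<le> B"
    using xlogx_bounded[OF b] by blast
  \<comment> \<open>Near \<open>r x = 0\<close> the logarithm is unbounded, but with the weight
    \<open>r x\<close> from the change of measure it becomes \<open>t * log b t\<close> on
    \<open>[0, K]\<close>.\<close>
  have "integrable (measure_pmf v) (\<lambda>x. r x * log b (r x))"
    using ratio_le[OF dom] r(2)
    by (intro measure_pmf.integrable_const_bound[where B = B])
       (auto simp: AE_measure_pmf_iff r_def simp del: times_divide_eq_left abs_divide intro!: B)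
  hence int_r: "integrable (measure_pmf \<mu>) (\<lambda>x. log b (r x))"
    by (subst integrable_pmf_density[OF r])
  have int_\<rho>: "integrable (measure_pmf \<mu>) (\<lambda>x. log b (\<rho> x))"
    unfolding \<rho>_def by (rule integrable_cell[OF P])
  let ?U = "\<lambda>x. log b (r x) - log b (\<rho> x) - log b c"
  have U: "integrable (measure_pmf \<mu>) ?U"
    using int_r int_\<rho> by simp
  \<comment> \<open>A point of the support of \<open>\<mu>\<close> has mass under \<open>v\<close>,
    and its cell has at least the \<open>\<mu>\<close>-mass of the point; this keeps every logarithm
    below within its domain.\<close>
  have \<mu>_pos: "0 < pmf v x" "0 < r x" "0 < \<rho> x" "0 < c * \<rho> x * pmf v x" if x: "x \<in> set_pmf \<mu>" for x
  proof -
    have "pmf \<mu> x > 0"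
      using x by (rule pmf_positive)
    thus v: "0 < pmf v x" and "0 < r x"
      using r[of x] pmf_nonneg[of v x] by (auto simp: zero_less_mult_iff)
    have "pmf \<mu> x \<le> measure_pmf.prob \<mu> (cell P x)"
      unfolding measure_pmf_single[symmetric]
      by (rule measure_pmf.finite_measure_mono) (use in_cell[OF P(1)] in auto)
    thus "0 < \<rho> x"
      using \<open>pmf \<mu> x > 0\<close> pos[OF cell_in_partition[OF P(1), of x]] by (simp add: \<rho>_def)
    thus "0 < c * \<rho> x * pmf v x"
      using v c by simp
  qed
  have sub: "set_pmf \<mu> \<subseteq> set_pmf q"
  proof
    fix x assume "x \<in> set_pmf \<mu>"
    thus "x \<in> set_pmf q"
      using \<mu>_pos(4)[of x] q[of x] by (auto simp: set_pmf_iff)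
  qed
  have le: "log b (pmf \<mu> x / pmf q x) \<le> ?U x" if x: "x \<in> set_pmf \<mu>" for x
  proof -
    note pos' = \<mu>_pos[OF x]
    have "pmf \<mu> x / pmf q x \<le> pmf \<mu> x / (c * \<rho> x * pmf v x)"
      using q[of x] pos' by (intro divide_left_mono) auto
    also have "\<dots> = r x / (c * \<rho> x)"
      using r(1)[of x] pos' by simp
    finally have "log b (pmf \<mu> x / pmf q x) \<le> log b (r x / (c * \<rho> x))"
      using b pos'(4) q[of x] pmf_positive[OF x] by (intro log_mono divide_pos_pos) auto
    also have "\<dots> = ?U x"
      using pos' c b by (simp add: log_divide log_mult)
    finally show ?thesis .
  qed
  show "0 \<le> idiv_pmf b \<mu> q"
    by (rule idiv_pmf_nonneg[OF b sub U le])
  have "idiv_pmf b \<mu> q \<le> ereal (measure_pmf.expectation \<mu> ?U)"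
    by (rule idiv_pmf_le[OF b sub U le])
  also have "measure_pmf.expectation \<mu> ?U
      = measure_pmf.expectation \<mu> (\<lambda>x. log b (r x)) - measure_pmf.expectation \<mu> (\<lambda>x. log b (\<rho> x)) - log b c"
    using int_r int_\<rho> by simp
  also have "measure_pmf.expectation \<mu> (\<lambda>x. log b (r x)) = measure_pmf.expectation v (\<lambda>x. r x * log b (r x))"
    by (rule expectation_pmf_density[OF r])
  also have "measure_pmf.expectation \<mu> (\<lambda>x. log b (\<rho> x)) = measure_pmf.expectation v (\<lambda>x. \<rho> x * log b (\<rho> x))"
    unfolding \<rho>_def by (rule expectation_xlogx_cell_ratio[OF P pos])
  finally show "idiv_pmf b \<mu> q \<le> ereal (measure_pmf.expectation v (\<lambda>x. r x * log b (r x))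
            - measure_pmf.expectation v (\<lambda>x. \<rho> x * log b (\<rho> x)) - log b c)" .
qed

subsection \<open>Concentration of the empirical measure\<close>

text \<open>\<open>stream_space M\<close> is the image of the product measure under
  \<open>to_stream\<close>, and reading off the entries inverts that map.\<close>

lemma distr_snth_PiM:
  assumes "prob_space M"
  shows "distr (stream_space M) (\<Pi>\<^sub>M i\<in>UNIV. M) (\<lambda>\<omega> n. \<omega> !! n) = (\<Pi>\<^sub>M i\<in>UNIV. M)"
proof -
  have "distr (stream_space M) (\<Pi>\<^sub>M i\<in>UNIV. M) (\<lambda>\<omega> n. \<omega> !! n)
      = distr (\<Pi>\<^sub>M i\<in>UNIV. M) (\<Pi>\<^sub>M i\<in>UNIV. M) ((\<lambda>\<omega> n. \<omega> !! n) \<circ> to_stream)"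
    by (subst stream_space_eq_distr, subst distr_distr) (auto intro: measurable_snth_PiM)
  also have "(\<lambda>\<omega> n. \<omega> !! n) \<circ> to_stream = (\<lambda>X. X)"
    by (auto simp: to_stream_def fun_eq_iff)
  finally show ?thesis
    by simp
qed

lemma distr_snth:
  assumes "prob_space M"
  shows "distr (stream_space M) M (\<lambda>\<omega>. \<omega> !! n) = M"
proof -
  have "distr (stream_space M) M (\<lambda>\<omega>. \<omega> !! n)
      = distr (distr (stream_space M) (\<Pi>\<^sub>M i\<in>UNIV. M) (\<lambda>\<omega> n. \<omega> !! n)) M (\<lambda>X. X n)"
    by (subst distr_distr) (auto intro: measurable_snth_PiM simp: comp_def)
  also have "\<dots> = M"
    unfolding distr_snth_PiM[OF assms] by (rule distr_PiM_component) (use assms in auto)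
  finally show ?thesis .
qed

text \<open>The joint law of the coordinates is the product of their marginals, by the two preceding
  lemmas.\<close>

lemma indep_vars_snth:
  assumes "prob_space M"
  shows "prob_space.indep_vars (stream_space M) (\<lambda>_. M) (\<lambda>i \<omega>. \<omega> !! i) UNIV"
proof -
  interpret S: prob_space "stream_space M"
    using assms by (rule prob_space.prob_space_stream_space)
  show ?thesis
    by (subst S.indep_vars_iff_distr_eq_PiM') (auto simp: distr_snth distr_snth_PiM[simplified] restrict_UNIV assms)
qed

lemma prob_empirical_deviation_le:
  assumes n: "n \<ge> 1" and \<epsilon>: "\<epsilon> \<ge> 0"
  shows "measure (stream_space (measure_pmf \<mu>))
      {\<omega> \<in> space (stream_space (measure_pmf \<mu>)).
        \<epsilon> \<le> \<bar>empirical \<omega> n A - measure_pmf.prob \<mu> A\<bar>} \<le> 2 * exp (- 2 * real n * \<epsilon>\<^sup>2)"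
proof -
  let ?S = "stream_space (measure_pmf \<mu>)"
  interpret S: prob_space ?S
    by (intro prob_space.prob_space_stream_space measure_pmf.prob_space_axioms)
  let ?X = "\<lambda>i \<omega>. indicator A (\<omega> !! i) :: real"
  have distr: "distr ?S borel (?X i) = distr (measure_pmf \<mu>) borel (indicator A)" for i
  proof -
    have "distr ?S borel (?X i) = distr (distr ?S (measure_pmf \<mu>) (\<lambda>\<omega>. \<omega> !! i)) borel (indicator A)"
      by (subst distr_distr) (auto simp: comp_def)
    thus ?thesis
      by (simp add: distr_snth measure_pmf.prob_space_axioms)
  qed
  have indep: "S.indep_vars (\<lambda>_. borel) ?X {..<n}"
    by (rule S.indep_vars_compose2[where M' = "\<lambda>_. measure_pmf \<mu>"])
       (auto intro: S.indep_vars_subset[OF indep_vars_snth] measure_pmf.prob_space_axioms)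
  have ex: "S.expectation (?X 0) = measure_pmf.prob \<mu> A"
  proof -
    have "S.expectation (?X 0) = integral\<^sup>L (distr ?S (measure_pmf \<mu>) (\<lambda>\<omega>. \<omega> !! 0)) (indicator A)"
      by (subst integral_distr) auto
    thus ?thesis
      unfolding distr_snth[OF measure_pmf.prob_space_axioms] by simp
  qed
  \<comment> \<open>Indicators take values in \<open>[0, 1]\<close>, and \<open>?X 0\<close> stands
    for their common law.\<close>
  interpret H: Hoeffding_ineq_iid ?S "{..<n}" ?X "?X 0" 0 1 "measure_pmf.prob \<mu> A"
  proof unfold_locales
    show "AE \<omega> in ?S. ?X 0 \<omega> \<in> {0..1}"
      by (simp add: indicator_def)
  next
    have "?X 0 \<in> borel_measurable ?S"
      by (rule measurable_compose[OF measurable_snth]) simp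
    thus "?X 0 \<in> borel_measurable ?S" .
  qed (use indep distr distr[of 0] ex in simp_all)
  have "\<epsilon> \<le> \<bar>empirical \<omega> n A - measure_pmf.prob \<mu> A\<bar>
      \<longleftrightarrow> real n * \<epsilon> \<le> \<bar>(\<Sum>i<n. ?X i \<omega>) - real n * measure_pmf.prob \<mu> A\<bar>" for \<omega>
  proof -
    have "(\<Sum>i<n. ?X i \<omega>) - real n * measure_pmf.prob \<mu> A
        = real n * (empirical \<omega> n A - measure_pmf.prob \<mu> A)"
      using n by (simp add: empirical_def right_diff_distrib)
    hence "\<bar>(\<Sum>i<n. ?X i \<omega>) - real n * measure_pmf.prob \<mu> A\<bar>
        = real n * \<bar>empirical \<omega> n A - measure_pmf.prob \<mu> A\<bar>"
      by (simp only: abs_mult abs_of_nat)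
    thus ?thesis
      using n by simp
  qed
  hence "{\<omega> \<in> space ?S. \<epsilon> \<le> \<bar>empirical \<omega> n A - measure_pmf.prob \<mu> A\<bar>}
      = {\<omega> \<in> space ?S. real n * \<epsilon> \<le> \<bar>(\<Sum>i<n. ?X i \<omega>) - real (card {..<n}) * measure_pmf.prob \<mu> A\<bar>}"
    by simp
  moreover have "{..<n} \<noteq> {}"
    using n by (simp add: lessThan_empty_iff)
  \<comment> \<open>For a deviation \<open>n \<epsilon>\<close> of a sum of \<open>n\<close>
    variables of range \<open>1\<close>, Hoeffding's exponent simplifies by a factor
    \<open>n\<close>.\<close>
  moreover have "- 2 * (real n * \<epsilon>)\<^sup>2 / (real (card {..<n}) * (1 - 0)\<^sup>2) = - 2 * real n * \<epsilon>\<^sup>2"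
    using n by (simp add: power2_eq_square)
  ultimately show ?thesis
    using H.Hoeffding_ineq_abs_ge[of "real n * \<epsilon>"] \<epsilon> by simp
qed

text \<open>Since \<open>\<tau> < 1/2\<close>, the exponent \<open>1 - 2 * \<tau>\<close> is
  positive and the stretched exponential beats every power; comparison with \<open>n powr -2\<close>
  suffices.\<close>

lemma summable_powr_exp:
  fixes \<tau> :: real
  assumes "0 < \<tau>" "\<tau> < 1/2"
  shows "summable (\<lambda>n. real n powr \<tau> * (2 * exp (- 2 * real n powr (1 - 2 * \<tau>))))"
proof (rule summable_comparison_test_bigo)
  show "summable (\<lambda>n. norm (real n powr -2))"
    using summable_real_powr_iff[of "-2"] by simp
  define s where "s = 1 - 2 * \<tau>"
  have "s > 0"
    using assms by (simp add: s_def)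
  hence "(\<lambda>x::real. x powr \<tau> * (2 * exp (- 2 * x powr s))) \<in> O(\<lambda>x. x powr -2)"
    using assms by real_asymp
  from landau_o.big.compose[OF this filterlim_real_sequentially]
  show "(\<lambda>n. real n powr \<tau> * (2 * exp (- 2 * real n powr (1 - 2 * \<tau>)))) \<in> O(\<lambda>n. real n powr -2)"
    by (simp add: s_def)
qed

lemma AE_empirical_uniformly_close:
  fixes a h :: "nat \<Rightarrow> real"
  assumes a_range: "\<And>n. 0 < a n \<and> a n < 1"
    and h_range: "\<And>n. 0 < h n \<and> h n < 1"
    and \<tau>: "0 < \<tau>" "\<tau> < 1/2"
    and rate: "(\<lambda>n. 1 / (a n * h n)) \<in> o(\<lambda>n. real n powr \<tau>)"
    and part: "\<And>n. admissible_partition v (h n) (\<pi> n)"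
  shows "AE \<omega> in stream_space (measure_pmf \<mu>).
      eventually (\<lambda>n. \<forall>A\<in>\<pi> n. \<bar>empirical \<omega> n A - measure_pmf.prob \<mu> A\<bar> < a n * h n) sequentially"
proof -
  let ?S = "stream_space (measure_pmf \<mu>)"
  interpret S: prob_space ?S
    by (intro prob_space.prob_space_stream_space measure_pmf.prob_space_axioms)
  define D where "D n A = {\<omega> \<in> space ?S. a n * h n \<le> \<bar>empirical \<omega> n A - measure_pmf.prob \<mu> A\<bar>}" for n A
  have D_sets: "D n A \<in> sets ?S" for n A
  proof -
    have [measurable]: "(\<lambda>\<omega>. indicator A (\<omega> !! k) :: real) \<in> borel_measurable ?S" for k
      by (rule measurable_compose[OF measurable_snth]) simp
    show ?thesis
      unfolding D_def empirical_def by measurable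
  qed
  have fin: "finite (\<pi> n)" for n
    using part[of n] by (simp add: admissible_partition_def)
  define E where "E n = (\<Union>A\<in>\<pi> n. D n A)" for n
  have E_sets: "E n \<in> sets ?S" for n
    unfolding E_def using fin D_sets by (intro sets.finite_UN) auto
  have "eventually (\<lambda>n. norm (1 / (a n * h n)) \<le> 1 * norm (real n powr \<tau>)) sequentially"
    using rate by (rule landau_o.smallD) simp
  hence ev: "eventually (\<lambda>n. norm (S.prob (E n))
      \<le> real n powr \<tau> * (2 * exp (- 2 * real n powr (1 - 2 * \<tau>)))) sequentially"
    using eventually_ge_at_top[of 1]
  proof eventually_elim
    case (elim n)
    have ah: "0 < a n * h n" "a n * h n \<le> h n"
      using a_range[of n] h_range[of n] by (auto simp: mult_le_cancel_right1)
    have le: "1 / (a n * h n) \<le> real n powr \<tau>"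
      using elim ah by simp
    have n: "real n > 0"
      using elim by simp
    \<comment> \<open>Squaring \<open>1 \<le> a n * h n * real n powr \<tau>\<close> turns the rate
      condition into a lower bound for the Hoeffding exponent.\<close>
    have "real n powr (1 - 2 * \<tau>) = real n / (real n powr \<tau>)\<^sup>2"
      using n by (simp add: powr_diff power2_eq_square powr_add[symmetric])
    also have "\<dots> \<le> real n * (a n * h n)\<^sup>2"
    proof -
      have "1 \<le> (a n * h n * real n powr \<tau>)"
        using le ah by (simp add: field_simps)
      hence "1 \<le> (a n * h n)\<^sup>2 * (real n powr \<tau>)\<^sup>2"
        unfolding power_mult_distrib[symmetric] by (rule one_le_power)
      thus ?thesis
        using n by (simp add: field_simps)
    qed
    finally have exp_le: "exp (- 2 * real n * (a n * h n)\<^sup>2) \<le> exp (- 2 * real n powr (1 - 2 * \<tau>))"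
      by simp
    have "S.prob (E n) \<le> (\<Sum>A\<in>\<pi> n. S.prob (D n A))"
      unfolding E_def using fin D_sets by (intro S.finite_measure_subadditive_finite) auto
    also have "\<dots> \<le> (\<Sum>A\<in>\<pi> n. 2 * exp (- 2 * real n * (a n * h n)\<^sup>2))"
      unfolding D_def using elim ah by (intro sum_mono prob_empirical_deviation_le) auto
    also have "\<dots> = real (card (\<pi> n)) * (2 * exp (- 2 * real n * (a n * h n)\<^sup>2))"
      by simp
    also have "\<dots> \<le> real n powr \<tau> * (2 * exp (- 2 * real n powr (1 - 2 * \<tau>)))"
    proof (intro mult_mono)
      \<comment> \<open>The rate bound serves a second time: as \<open>a n < 1\<close>, it also
        limits the number of cells, at most \<open>1 / h n\<close>.\<close>
      have "real (card (\<pi> n)) \<le> 1 / h n"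
        using part h_range by (intro card_admissible_partition_le) auto
      also have "\<dots> \<le> 1 / (a n * h n)"
        using ah by (intro divide_left_mono) auto
      finally show "real (card (\<pi> n)) \<le> real n powr \<tau>"
        using le by simp
    qed (use exp_le in auto)
    finally show ?case
      by simp
  qed
  have "summable (\<lambda>n. S.prob (E n))"
    by (rule summable_comparison_test_ev[OF ev summable_powr_exp[OF \<tau>]])
  hence "AE \<omega> in ?S. eventually (\<lambda>n. \<omega> \<in> space ?S - E n) sequentially"
    using E_sets by (intro borel_cantelli_AE1) (auto simp: S.emeasure_eq_measure)
  thus ?thesis
    by eventually_elim (auto elim!: eventually_mono simp: E_def D_def not_le)
qed

subsection \<open>The Barron estimate\<close>

text \<open>\<open>embed_pmf\<close> is known to return its argument only if that is nonnegative
  with total mass \<open>1\<close>. Summed over cells, the cell masses of \<open>v\<close> cancel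
  and leave \<open>(1 - a n) + a n\<close>; for \<open>n = 0\<close> the empirical part would
  contribute nothing.\<close>

lemma pmf_barron:
  assumes P: "admissible_partition v (h n) (\<pi> n)" and h: "h n > 0"
    and a: "0 < a n" "a n < 1" and n: "n \<ge> 1"
  shows "pmf (barron v \<pi> a \<omega> n) x = pmf v x *
    ((1 - a n) * empirical \<omega> n (cell (\<pi> n) x) / measure_pmf.prob v (cell (\<pi> n) x) + a n)"
proof -
  let ?G = "\<lambda>A. (1 - a n) * empirical \<omega> n A / measure_pmf.prob v A + a n"
  have P': "partition_on UNIV (\<pi> n)" "finite (\<pi> n)" "\<And>A. A \<in> \<pi> n \<Longrightarrow> measure_pmf.prob v A > 0"
    using P h by (auto simp: admissible_partition_def intro: less_le_trans)
  have emp: "empirical \<omega> n A \<ge> 0" for A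
    by (auto simp: empirical_def intro!: divide_nonneg_nonneg sum_nonneg)
  have G: "?G A \<ge> 0" for A
    using a emp[of A] by (intro add_nonneg_nonneg divide_nonneg_nonneg mult_nonneg_nonneg) auto
  have "measure_pmf.expectation v (\<lambda>x. ?G (cell (\<pi> n) x)) = (\<Sum>A\<in>\<pi> n. ?G A * measure_pmf.prob v A)"
    by (rule expectation_cell[OF P'(1,2)])
  also have "\<dots> = (\<Sum>A\<in>\<pi> n. (1 - a n) * empirical \<omega> n A + a n * measure_pmf.prob v A)"
    by (intro sum.cong refl) (auto simp: distrib_right dest: P'(3))
  also have "\<dots> = 1"
    by (simp add: sum.distrib sum_distrib_left[symmetric] sum_empirical_partition[OF P'(1,2) n]
        sum_prob_partition[OF P'(1,2)])
  finally have "(\<integral>\<^sup>+ x. ennreal (?G (cell (\<pi> n) x)) \<partial>measure_pmf v) = 1"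
    using nn_integral_eq_integral[OF integrable_cell[OF P'(1,2), of v ?G]] G by simp
  hence "(\<integral>\<^sup>+ x. ennreal (pmf v x * ?G (cell (\<pi> n) x)) \<partial>count_space UNIV) = 1"
    by (simp add: nn_integral_measure_pmf ennreal_mult')
  thus ?thesis
    unfolding barron_def using G by (subst pmf_embed_pmf) (auto intro!: mult_nonneg_nonneg)
qed

text \<open>A cell is the atom \<open>x\<close> plus a remainder of \<open>v\<close>-mass below
  \<open>h n\<close> once \<open>h n \<le> pmf v x\<close>, hence of \<open>\<mu>\<close>-mass at
  most \<open>K * h n\<close>. Both cell masses therefore converge to the atoms.\<close>

lemma cell_ratio_tendsto:
  fixes K :: real
  assumes part: "\<And>n. maximal_admissible_partition v (h n) (\<pi> n)"
    and h_pos: "\<And>n. 0 < h n" and h_lim: "h \<longlonglongrightarrow> 0"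
    and dom: "\<And>x. pmf \<mu> x \<le> K * pmf v x" and x: "x \<in> set_pmf v"
  shows "(\<lambda>n. measure_pmf.prob \<mu> (cell (\<pi> n) x) / measure_pmf.prob v (cell (\<pi> n) x))
    \<longlonglongrightarrow> pmf \<mu> x / pmf v x"
proof -
  \<comment> \<open>Stated for any \<open>p\<close> dominated by \<open>v\<close>, to be used for
    \<open>\<mu>\<close> with \<open>K\<close> and for \<open>v\<close> itself with the constant
    \<open>1\<close>.\<close>
  have lim: "(\<lambda>n. measure_pmf.prob p (cell (\<pi> n) x)) \<longlonglongrightarrow> pmf p x"
    if p: "\<And>x. pmf p x \<le> L * pmf v x" for p L
  proof -
    have split: "measure_pmf.prob p (cell (\<pi> n) x) = pmf p x + measure_pmf.prob p (cell (\<pi> n) x - {x})" for n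
    proof -
      have "x \<in> cell (\<pi> n) x"
        using part[of n] by (intro in_cell) (auto simp: maximal_admissible_partition_def admissible_partition_def)
      thus ?thesis
        using measure_pmf.finite_measure_Diff[of "cell (\<pi> n) x" p "{x}"] by (simp add: measure_pmf_single)
    qed
    have "L \<ge> 0"
      using order.trans[OF pmf_nonneg p, of x] pmf_positive[OF x] by (simp add: zero_le_mult_iff)
    have "eventually (\<lambda>n. h n \<le> pmf v x) sequentially"
      using order_tendstoD(2)[OF h_lim, of "pmf v x"] x
      by (auto simp: pmf_positive elim!: eventually_mono)
    hence "eventually (\<lambda>n. measure_pmf.prob p (cell (\<pi> n) x - {x}) \<le> L * h n) sequentially"
    proof eventually_elim
      case (elim n)
      have "measure_pmf.prob p (cell (\<pi> n) x - {x}) \<le> L * measure_pmf.prob v (cell (\<pi> n) x - {x})"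
        by (rule measure_le_of_dominated[OF p])
      also have "\<dots> \<le> L * h n"
        using prob_cell_minus_atom_less[OF part h_pos elim] \<open>L \<ge> 0\<close> by (intro mult_left_mono) auto
      finally show ?case .
    qed
    moreover have "(\<lambda>n. L * h n) \<longlonglongrightarrow> 0"
      using tendsto_mult_right_zero[OF h_lim] .
    ultimately have "(\<lambda>n. measure_pmf.prob p (cell (\<pi> n) x - {x})) \<longlonglongrightarrow> 0"
      by (rule tendsto_sandwich[OF always_eventually _ tendsto_const, rotated]) simp
    from tendsto_add[OF tendsto_const[of "pmf p x"] this] show ?thesis
      unfolding split by simp
  qed
  show ?thesis
    using x by (intro tendsto_divide lim[OF dom] lim[of v 1]) (auto simp: set_pmf_iff)
qed

text \<open>The tolerance \<open>a n * h n\<close> is at most \<open>a n\<close> times the cell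
  mass, so the empirical cell ratio differs from \<open>\<rho>\<close> by at most
  \<open>a n\<close>.\<close>

lemma barron_bounds:
  fixes K :: real
  assumes P: "admissible_partition v (h n) (\<pi> n)" and h: "h n > 0"
    and a: "0 < a n" "a n < 1" and n: "n \<ge> 1"
    and dom: "\<And>x. pmf \<mu> x \<le> K * pmf v x"
    and close: "\<And>A. A \<in> \<pi> n \<Longrightarrow> \<bar>empirical \<omega> n A - measure_pmf.prob \<mu> A\<bar> < a n * h n"
  defines "\<rho> \<equiv> \<lambda>x. measure_pmf.prob \<mu> (cell (\<pi> n) x) / measure_pmf.prob v (cell (\<pi> n) x)"
  shows "(1 - a n) * \<rho> x * pmf v x \<le> pmf (barron v \<pi> a \<omega> n) x"
    and "pmf (barron v \<pi> a \<omega> n) x \<le> (\<rho> x + 2 * a n) * pmf v x"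
proof -
  define A where "A = cell (\<pi> n) x"
  define e where "e = empirical \<omega> n A / measure_pmf.prob v A"
  have A: "A \<in> \<pi> n"
    using P unfolding A_def by (intro cell_in_partition) (simp add: admissible_partition_def)
  hence vA: "h n \<le> measure_pmf.prob v A"
    using P by (simp add: admissible_partition_def)
  have "\<bar>e - \<rho> x\<bar> = \<bar>empirical \<omega> n A - measure_pmf.prob \<mu> A\<bar> / measure_pmf.prob v A"
    using vA h by (simp add: e_def \<rho>_def A_def[symmetric] diff_divide_distrib[symmetric])
  also have "\<dots> \<le> a n * measure_pmf.prob v A / measure_pmf.prob v A"
  proof (rule divide_right_mono)
    have "a n * h n \<le> a n * measure_pmf.prob v A"
      using vA a by (intro mult_left_mono) auto
    thus "\<bar>empirical \<omega> n A - measure_pmf.prob \<mu> A\<bar> \<le> a n * measure_pmf.prob v A"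
      using close[OF A] by linarith
  qed simp
  also have "\<dots> = a n"
    using vA h by simp
  finally have e: "\<rho> x - a n \<le> e" "e \<le> \<rho> x + a n"
    by auto
  have \<rho>: "\<rho> x \<ge> 0"
    by (simp add: \<rho>_def)
  \<comment> \<open>The deviation costs at most \<open>(1 - a n) * a n\<close>, which the mixing
    weight \<open>a n\<close> pays back. The lower bound is thus purely multiplicative, as the
    logarithm in the divergence needs.\<close>
  have "(1 - a n) * \<rho> x = (1 - a n) * (\<rho> x - a n) + (1 - a n) * a n"
    by (simp add: algebra_simps)
  also have "\<dots> \<le> (1 - a n) * e + 1 * a n"
    using a e by (intro add_mono mult_left_mono mult_right_mono) auto
  finally have lower: "(1 - a n) * \<rho> x \<le> (1 - a n) * e + a n"
    by simp
  \<comment> \<open>One \<open>a n\<close> comes from the deviation, the other from the mixing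
    term.\<close>
  have "(1 - a n) * e + a n \<le> (1 - a n) * (\<rho> x + a n) + a n"
    using a e by (intro add_mono mult_left_mono) auto
  also have "\<dots> \<le> 1 * (\<rho> x + a n) + a n"
    using a \<rho> by (intro add_mono mult_right_mono) auto
  finally have upper: "(1 - a n) * e + a n \<le> \<rho> x + 2 * a n"
    by simp
  have "pmf (barron v \<pi> a \<omega> n) x = pmf v x * ((1 - a n) * e + a n)"
    using pmf_barron[of v h n \<pi> a \<omega> x, OF P h a n] by (simp add: e_def A_def)
  with lower upper show "(1 - a n) * \<rho> x * pmf v x \<le> pmf (barron v \<pi> a \<omega> n) x"
    and "pmf (barron v \<pi> a \<omega> n) x \<le> (\<rho> x + 2 * a n) * pmf v x"
    using mult_left_mono[OF lower, of "pmf v x"] mult_left_mono[OF upper, of "pmf v x"]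
    by (simp_all add: mult.commute)
qed

text \<open>The deterministic half of the argument: \<open>\<omega>\<close> is a fixed path, and
  \<open>close\<close> is what almost every path satisfies.\<close>

lemma barron_limits:
  fixes b K :: real and v \<mu> :: "'a pmf" and a h :: "nat \<Rightarrow> real"
  assumes b: "b > 1" and v_ent: "entropy_pmf b v < \<infinity>"
    and dom: "\<And>x. pmf \<mu> x \<le> K * pmf v x"
    and a_range: "\<And>n. 0 < a n \<and> a n < 1" and h_pos: "\<And>n. 0 < h n"
    and a_lim: "a \<longlonglongrightarrow> 0" and h_lim: "h \<longlonglongrightarrow> 0"
    and part: "\<And>n. maximal_admissible_partition v (h n) (\<pi> n)"
    and close: "eventually (\<lambda>n. \<forall>A\<in>\<pi> n. \<bar>empirical \<omega> n A - measure_pmf.prob \<mu> A\<bar> < a n * h n) sequentially"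
  shows "(\<lambda>n. entropy_pmf b (barron v \<pi> a \<omega> n)) \<longlonglongrightarrow> entropy_pmf b \<mu>" (is ?H)
    and "(\<lambda>n. idiv_pmf b \<mu> (barron v \<pi> a \<omega> n)) \<longlonglongrightarrow> 0" (is ?D)
proof -
  let ?q = "barron v \<pi> a \<omega>"
  define \<rho> where "\<rho> n x = measure_pmf.prob \<mu> (cell (\<pi> n) x) / measure_pmf.prob v (cell (\<pi> n) x)" for n x
  define r where "r x = pmf \<mu> x / pmf v x" for x
  have adm: "admissible_partition v (h n) (\<pi> n)" for n
    using part by (simp add: maximal_admissible_partition_def)
  have P: "partition_on UNIV (\<pi> n)" "finite (\<pi> n)" "\<And>A. A \<in> \<pi> n \<Longrightarrow> measure_pmf.prob v A > 0" for n
    using adm[of n] h_pos[of n] by (auto simp: admissible_partition_def intro: less_le_trans)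
  have \<rho>_le: "0 \<le> \<rho> n x" "\<rho> n x \<le> K" for n x
    using measure_le_of_dominated[OF dom] P(3)[OF cell_in_partition[OF P(1)]]
    by (auto simp: \<rho>_def pos_divide_le_eq)
  have \<rho>_lim: "(\<lambda>n. \<rho> n x) \<longlonglongrightarrow> r x" if "x \<in> set_pmf v" for x
    unfolding \<rho>_def r_def by (rule cell_ratio_tendsto[OF part h_pos h_lim dom that])
  have bounds: "eventually (\<lambda>n. \<forall>x. (1 - a n) * \<rho> n x * pmf v x \<le> pmf (?q n) x
      \<and> pmf (?q n) x \<le> (\<rho> n x + 2 * a n) * pmf v x) sequentially"
    using close eventually_ge_at_top[of 1]
  proof eventually_elim
    case (elim n)
    thus ?case
      using barron_bounds[of v h n \<pi> a \<mu> K \<omega>] adm[of n] h_pos[of n] a_range[of n] dom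
      unfolding \<rho>_def by blast
  qed
  show ?H
  proof (rule entropy_tendsto_of_dominated[OF b v_ent])
    \<comment> \<open>\<open>K + 2\<close> exceeds \<open>\<rho> n x + 2 * a n\<close>, since
      \<open>\<rho> n x \<le> K\<close> and \<open>a n < 1\<close>.\<close>
    show "pmf \<mu> x \<le> (K + 2) * pmf v x" for x
      using dom[of x] mult_right_mono[of K "K + 2" "pmf v x"] by auto
    show "eventually (\<lambda>n. \<forall>x. pmf (?q n) x \<le> (K + 2) * pmf v x) sequentially"
      using bounds
    proof (eventually_elim, intro allI)
      fix n x
      assume "\<forall>x. (1 - a n) * \<rho> n x * pmf v x \<le> pmf (?q n) x
        \<and> pmf (?q n) x \<le> (\<rho> n x + 2 * a n) * pmf v x"
      hence "pmf (?q n) x \<le> (\<rho> n x + 2 * a n) * pmf v x"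
        by blast
      also have "\<dots> \<le> (K + 2) * pmf v x"
        using \<rho>_le(2)[of n x] a_range[of n] by (intro mult_right_mono) auto
      finally show "pmf (?q n) x \<le> (K + 2) * pmf v x" .
    qed
  next
    fix x assume x: "x \<in> set_pmf v"
    show "(\<lambda>n. pmf (?q n) x) \<longlonglongrightarrow> pmf \<mu> x"
    proof (rule tendsto_sandwich)
      have "(\<lambda>n. (1 - a n) * \<rho> n x * pmf v x) \<longlonglongrightarrow> (1 - 0) * r x * pmf v x"
        by (intro tendsto_intros a_lim \<rho>_lim x)
      thus "(\<lambda>n. (1 - a n) * \<rho> n x * pmf v x) \<longlonglongrightarrow> pmf \<mu> x"
        using x by (simp add: r_def set_pmf_iff)
      have "(\<lambda>n. (\<rho> n x + 2 * a n) * pmf v x) \<longlonglongrightarrow> (r x + 2 * 0) * pmf v x"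
        by (intro tendsto_intros a_lim \<rho>_lim x)
      thus "(\<lambda>n. (\<rho> n x + 2 * a n) * pmf v x) \<longlonglongrightarrow> pmf \<mu> x"
        using x by (simp add: r_def set_pmf_iff)
    qed (use bounds in \<open>auto elim!: eventually_mono\<close>)
  qed
  define \<Phi> where "\<Phi> f = measure_pmf.expectation v (\<lambda>x. f x * log b (f x))" for f
  obtain B where B: "\<And>t. 0 \<le> t \<Longrightarrow> t \<le> K \<Longrightarrow> \<bar>t * log b t\<bar> \<le> B"
    using xlogx_bounded[OF b] by blast
  \<comment> \<open>All \<open>\<rho> n x\<close> stay in \<open>[0, K]\<close>, so a constant
    dominates; this limit closes the gap between cell ratios and pointwise ratios.\<close>
  have "(\<lambda>n. \<Phi> (\<rho> n)) \<longlonglongrightarrow> \<Phi> r"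
    unfolding \<Phi>_def
  proof (rule pmf_dominated_convergence)
    show "integrable (measure_pmf v) (\<lambda>_. B)"
      by simp
    show "eventually (\<lambda>n. \<forall>x\<in>set_pmf v. \<bar>\<rho> n x * log b (\<rho> n x)\<bar> \<le> B) sequentially"
      using B \<rho>_le by (intro always_eventually) auto
    show "(\<lambda>n. \<rho> n x * log b (\<rho> n x)) \<longlonglongrightarrow> r x * log b (r x)" if "x \<in> set_pmf v" for x
      using \<rho>_le by (intro tendsto_xlogx[OF b \<rho>_lim[OF that]]) auto
  qed
  hence "(\<lambda>n. \<Phi> r - \<Phi> (\<rho> n) - log b (1 - a n)) \<longlonglongrightarrow> \<Phi> r - \<Phi> r - log b (1 - 0)"
    using b by (intro tendsto_intros a_lim) auto
  hence lim: "(\<lambda>n. ereal (\<Phi> r - \<Phi> (\<rho> n) - log b (1 - a n))) \<longlonglongrightarrow> 0"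
    by (simp add: zero_ereal_def)
  have ev: "eventually (\<lambda>n. 0 \<le> idiv_pmf b \<mu> (?q n)
      \<and> idiv_pmf b \<mu> (?q n) \<le> ereal (\<Phi> r - \<Phi> (\<rho> n) - log b (1 - a n))) sequentially"
    using bounds
  proof eventually_elim
    case (elim n)
    have c: "0 < 1 - a n"
      using a_range[of n] by simp
    from elim have "\<And>x. (1 - a n) * (measure_pmf.prob \<mu> (cell (\<pi> n) x) / measure_pmf.prob v (cell (\<pi> n) x))
        * pmf v x \<le> pmf (?q n) x"
      unfolding \<rho>_def by blast
    from idiv_pmf_cell_ratio_bounds[OF b dom P c this]
    show ?case
      unfolding \<Phi>_def \<rho>_def r_def by auto
  qed
  show ?D
    by (rule tendsto_sandwich[OF _ _ tendsto_const lim]) (use ev in \<open>auto elim!: eventually_mono\<close>)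
qed

lemma dominated_of_ratio_bounded:
  assumes ac: "absolutely_continuous (measure_pmf v) (measure_pmf \<mu>)"
    and sup_fin: "(SUP x\<in>set_pmf \<mu>. ereal (pmf \<mu> x / pmf v x)) < \<infinity>"
  obtains K :: real where "\<And>x. pmf \<mu> x \<le> K * pmf v x"
proof -
  obtain K where K: "(SUP x\<in>set_pmf \<mu>. ereal (pmf \<mu> x / pmf v x)) < ereal K"
    using sup_fin by (metis ereal_dense2)
  \<comment> \<open>The absolute value makes the constant nonnegative, which settles the points off
    the support of \<open>\<mu>\<close>.\<close>
  have "pmf \<mu> x \<le> \<bar>K\<bar> * pmf v x" for x
  proof (cases "x \<in> set_pmf \<mu>")
    case True
    have "ereal (pmf \<mu> x / pmf v x) \<le> (SUP x\<in>set_pmf \<mu>. ereal (pmf \<mu> x / pmf v x))"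
      using True by (rule SUP_upper)
    hence "pmf \<mu> x / pmf v x \<le> \<bar>K\<bar>"
      using K by (metis abs_ge_self ereal_less_eq(3) less_imp_le order.trans)
    moreover have "pmf v x > 0"
      using True ac by (auto simp: absolutely_continuous_measure_pmf_iff intro: pmf_positive)
    ultimately show ?thesis
      by (simp add: pos_divide_le_eq)
  qed (auto simp: set_pmf_iff)
  thus thesis
    using that by blast
qed

theorem theorem3:
  fixes b :: real and v \<mu> :: "'a::countable pmf"
    and a h :: "nat \<Rightarrow> real" and \<pi> :: "nat \<Rightarrow> 'a set set"
  assumes b: "b > 1"
    and X_inf: "infinite (UNIV :: 'a set)"
    and v_supp: "infinite (set_pmf v)"
    and v_ent: "entropy_pmf b v < \<infinity>"
    and ac: "absolutely_continuous (measure_pmf v) (measure_pmf \<mu>)"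
    and inf_pos: "0 < (INF x\<in>set_pmf \<mu>. ereal (pmf \<mu> x / pmf v x))"
    and sup_fin: "(SUP x\<in>set_pmf \<mu>. ereal (pmf \<mu> x / pmf v x)) < \<infinity>"
    and a_range: "\<And>n. 0 < a n \<and> a n < 1"
    and h_range: "\<And>n. 0 < h n \<and> h n < 1"
    and a_lim: "a \<longlonglongrightarrow> 0"
    and h_lim: "h \<longlonglongrightarrow> 0"
    and rate: "\<exists>\<tau>::real. 0 < \<tau> \<and> \<tau> < 1/2 \<and>
                 (\<lambda>n. 1 / (a n * h n)) \<in> o(\<lambda>n. real n powr \<tau>)"
    and part: "\<And>n. maximal_admissible_partition v (h n) (\<pi> n)"
  shows "entropy_pmf b \<mu> < \<infinity>
    \<and> (\<forall>\<omega>. \<forall>n\<ge>1. absolutely_continuous (measure_pmf (barron v \<pi> a \<omega> n)) (measure_pmf \<mu>))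
    \<and> (AE \<omega> in stream_space (measure_pmf \<mu>).
          (\<lambda>n. entropy_pmf b (barron v \<pi> a \<omega> n)) \<longlonglongrightarrow> entropy_pmf b \<mu>
        \<and> (\<lambda>n. idiv_pmf b \<mu> (barron v \<pi> a \<omega> n)) \<longlonglongrightarrow> 0)"
proof (intro conjI allI impI)
  obtain K where dom: "\<And>x. pmf \<mu> x \<le> K * pmf v x"
    using dominated_of_ratio_bounded[OF ac sup_fin] by blast
  obtain \<tau> :: real where \<tau>: "0 < \<tau>" "\<tau> < 1/2" "(\<lambda>n. 1 / (a n * h n)) \<in> o(\<lambda>n. real n powr \<tau>)"
    using rate by blast
  have adm: "admissible_partition v (h n) (\<pi> n)" for n
    using part by (simp add: maximal_admissible_partition_def)
  have h_pos: "0 < h n" for n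
    using h_range by blast
  show "entropy_pmf b \<mu> < \<infinity>"
    using entropy_of_dominated[OF b v_ent dom] by simp
  \<comment> \<open>Every path works: the mixing term alone gives each atom at least
    \<open>a n * pmf v x\<close>, and the support of \<open>v\<close> contains that of
    \<open>\<mu>\<close>.\<close>
  show "absolutely_continuous (measure_pmf (barron v \<pi> a \<omega> n)) (measure_pmf \<mu>)" if n: "n \<ge> 1" for \<omega> n
    unfolding absolutely_continuous_measure_pmf_iff
  proof
    fix x assume "x \<in> set_pmf \<mu>"
    hence v: "pmf v x > 0"
      using ac by (auto simp: absolutely_continuous_measure_pmf_iff intro: pmf_positive)
    have "0 \<le> (1 - a n) * empirical \<omega> n (cell (\<pi> n) x) / measure_pmf.prob v (cell (\<pi> n) x)"
      using a_range[of n] by (auto simp: empirical_def intro!: divide_nonneg_nonneg mult_nonneg_nonneg sum_nonneg)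
    hence "pmf (barron v \<pi> a \<omega> n) x > 0"
      using v a_range[of n] pmf_barron[of v h n \<pi> a \<omega> x] adm[of n] h_pos[of n] n
      by (simp add: add_nonneg_pos)
    thus "x \<in> set_pmf (barron v \<pi> a \<omega> n)"
      by (simp add: set_pmf_iff)
  qed
  show "AE \<omega> in stream_space (measure_pmf \<mu>).
          (\<lambda>n. entropy_pmf b (barron v \<pi> a \<omega> n)) \<longlonglongrightarrow> entropy_pmf b \<mu>
        \<and> (\<lambda>n. idiv_pmf b \<mu> (barron v \<pi> a \<omega> n)) \<longlonglongrightarrow> 0"
    using AE_empirical_uniformly_close[OF a_range h_range \<tau> adm]
    by eventually_elim
       (use barron_limits[OF b v_ent dom a_range h_pos a_lim h_lim part] in blast)
qed

end
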